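(* Let $(X,d)$ be a compact metric space, $f:X\to X$ a homeomorphism, $p>0$, and $\pi_0$ an ergodic $f$-invariant Borel probability measure on $X$. Let $C_0$ be the smallest channel capacity above which the objective (E3) of asymptotic estimation in expectation (with exponent $p$) can be achieved for every $\varepsilon>0$. Then $$C_0\ \le\ \log\bigl(1+\lfloor 2^{h_{\pi_0}(f)}\rfloor\bigr).$$
   Context: All logarithms are to base $2$, and $\log\infty:=\infty$ (so the bound is trivial if the entropy is $+\infty$). The system is $x_{t+1}=f(x_t)$ with random initial state $x_0$ distributed according to $\pi_0$. Policies: given a finite nonempty alphabet $\mathcal{M}$ (noiseless channel of capacity $C=\log|\mathcal{M}|$), a coding and estimation policy consists of measurable maps $\delta_t:X^{t+1}\to\mathcal{M}$ and maps $\gamma_t:\mathcal{M}^{t+1}\to X$, $t=0,1,2,\dots$. For initial state $x_0$, put $x_t=f^t(x_0)$, $q_t=\delta_t(x_0,x_1,\dots,x_t)$ and $\hat{x}_t=\hat{x}_t(x_0)=\gamma_t(q_0,q_1,\dots,q_t)$. Objective (E3) for a given $\varepsilon>0$: $\limsup_{t\to\infty}\int_X d(f^t(x_0),\hat{x}_t(x_0))^p\,\pi_0(\mathrm{d}x_0)\le\varepsilon$. $C_0$: for $\varepsilon>0$ let $C_\varepsilon$ be the infimum of $\log|\mathcal{M}|$ over all finite alphabets $\mathcal{M}$ for which there is a coding and estimation policy achieving the objective for this $\varepsilon$ (with $\inf\emptyset=\infty$); then $C_0:=\lim_{\varepsilon\downarrow0}C_\varepsilon$. Metric entropy: for a finite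 Borel partition $\mathcal{P}$ of $X$, $\mathcal{P}^n:=\bigvee_{i=0}^{n-1}f^{-i}\mathcal{P}$, $H_{\pi_0}(\mathcal{P}^n)=-\sum_{P\in\mathcal{P}^n}\pi_0(P)\log\pi_0(P)$, $h_{\pi_0}(f;\mathcal{P}):=\lim_{n\to\infty}\frac1nH_{\pi_0}(\mathcal{P}^n)$, and $h_{\pi_0}(f):=\sup_{\mathcal{P}}h_{\pi_0}(f;\mathcal{P})\in[0,\infty]$ over all finite Borel partitions. *)

theory Defs
  imports "HOL-Probability.Probability"
begin

section \<open>Ergodic invariant Borel measures\<close>

definition invariant_borel_prob :: "'a::topological_space measure \<Rightarrow> ('a \<Rightarrow> 'a) \<Rightarrow> bool" where
  "invariant_borel_prob \<mu> f \<longleftrightarrow>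
     prob_space \<mu> \<and> sets \<mu> = sets borel \<and> (\<forall>A\<in>sets borel. measure \<mu> (f -` A) = measure \<mu> A)"

definition ergodic_measure :: "'a::topological_space measure \<Rightarrow> ('a \<Rightarrow> 'a) \<Rightarrow> bool" where
  "ergodic_measure \<mu> f \<longleftrightarrow>
     invariant_borel_prob \<mu> f \<and>
     (\<forall>A\<in>sets borel. f -` A = A \<longrightarrow> measure \<mu> A = 0 \<or> measure \<mu> A = 1)"

section \<open>Metric entropy\<close>

definition finite_borel_partition :: "'a::topological_space set set \<Rightarrow> bool" where
  "finite_borel_partition P \<longleftrightarrow> finite P \<and> P \<subseteq> sets borel \<and> partition_on UNIV P"

text \<open>The members of the join of the partitions \<open>f\<^sup>-\<^sup>iP\<close>, \<open>i < n\<close>, are the nonempty intersections of one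
  member from each.\<close>

definition iterated_join :: "('a \<Rightarrow> 'a) \<Rightarrow> 'a set set \<Rightarrow> nat \<Rightarrow> 'a set set" where
  "iterated_join f P n = (\<lambda>A. \<Inter>i<n. (f ^^ i) -` A i) ` ({..<n} \<rightarrow>\<^sub>E P) - {{}}"

text \<open>Since \<open>log 2 0 = 0\<close>, the convention \<open>0 log 0 = 0\<close> holds automatically.\<close>

definition partition_entropy :: "'a measure \<Rightarrow> 'a set set \<Rightarrow> real" where
  "partition_entropy \<mu> P = - (\<Sum>A\<in>P. measure \<mu> A * log 2 (measure \<mu> A))"

definition entropy_wrt_partition :: "'a measure \<Rightarrow> ('a \<Rightarrow> 'a) \<Rightarrow> 'a set set \<Rightarrow> real" where
  "entropy_wrt_partition \<mu> f P =
     lim (\<lambda>n. 1 / real n * partition_entropy \<mu> (iterated_join f P n))"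

definition metric_entropy :: "'a::topological_space measure \<Rightarrow> ('a \<Rightarrow> 'a) \<Rightarrow> ereal" where
  "metric_entropy \<mu> f =
     (SUP P\<in>{P. finite_borel_partition P}. ereal (entropy_wrt_partition \<mu> f P))"

section \<open>Coding and estimation policies\<close>

text \<open>A tuple indexed by \<open>0, \<dots>, t\<close> is an extensional function on \<open>{..t}\<close>. Alphabets are finite
  nonempty sets of natural numbers, which loses no generality since only the cardinality of an
  alphabet matters. On a compact (hence second countable) metric space, the product
  sigma-algebra on \<open>(t + 1)\<close>-tuples is the Borel one. The coder maps \<open>\<delta> t\<close> have to be measurable; the
  estimator maps \<open>\<gamma> t\<close> on tuples of symbols are arbitrary.\<close>

definition coding_policy ::
  "nat set \<Rightarrow> (nat \<Rightarrow> (nat \<Rightarrow> 'a::topological_space) \<Rightarrow> nat) \<Rightarrow> bool" where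
  "coding_policy M \<delta> \<longleftrightarrow>
     (\<forall>t. \<delta> t \<in> measurable (Pi\<^sub>M {..t} (\<lambda>_. borel)) (count_space M))"

definition channel_symbol ::
  "('a \<Rightarrow> 'a) \<Rightarrow> (nat \<Rightarrow> (nat \<Rightarrow> 'a) \<Rightarrow> nat) \<Rightarrow> 'a \<Rightarrow> nat \<Rightarrow> nat" where
  "channel_symbol f \<delta> x t = \<delta> t (\<lambda>i\<in>{..t}. (f ^^ i) x)"

definition estimate ::
  "('a \<Rightarrow> 'a) \<Rightarrow> (nat \<Rightarrow> (nat \<Rightarrow> 'a) \<Rightarrow> nat) \<Rightarrow> (nat \<Rightarrow> (nat \<Rightarrow> nat) \<Rightarrow> 'a) \<Rightarrow> 'a \<Rightarrow> nat \<Rightarrow> 'a" where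
  "estimate f \<delta> \<gamma> x t = \<gamma> t (\<lambda>s\<in>{..t}. channel_symbol f \<delta> x s)"

definition achieves_E3 ::
  "('a::metric_space \<Rightarrow> 'a) \<Rightarrow> 'a measure \<Rightarrow> real \<Rightarrow> real \<Rightarrow>
     (nat \<Rightarrow> (nat \<Rightarrow> 'a) \<Rightarrow> nat) \<Rightarrow> (nat \<Rightarrow> (nat \<Rightarrow> nat) \<Rightarrow> 'a) \<Rightarrow> bool" where
  "achieves_E3 f \<mu> p \<epsilon> \<delta> \<gamma> \<longleftrightarrow>
     limsup (\<lambda>t. \<integral>\<^sup>+ x. ennreal (dist ((f ^^ t) x) (estimate f \<delta> \<gamma> x t) powr p) \<partial>\<mu>) \<le> ennreal \<epsilon>"

text \<open>The infimum is taken in the extended reals, so \<open>Inf {} = \<infinity>\<close>.\<close>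

definition capacity_eps ::
  "('a::metric_space \<Rightarrow> 'a) \<Rightarrow> 'a measure \<Rightarrow> real \<Rightarrow> real \<Rightarrow> ereal" where
  "capacity_eps f \<mu> p \<epsilon> =
     Inf {ereal (log 2 (real (card M))) | M.
            finite M \<and> M \<noteq> {} \<and> (\<exists>\<delta> \<gamma>. coding_policy M \<delta> \<and> achieves_E3 f \<mu> p \<epsilon> \<delta> \<gamma>)}"

definition smallest_capacity :: "('a::metric_space \<Rightarrow> 'a) \<Rightarrow> 'a measure \<Rightarrow> real \<Rightarrow> ereal" where
  "smallest_capacity f \<mu> p = Lim (at_right 0) (capacity_eps f \<mu> p)"

text \<open>The limit always exists, by monotonicity.\<close>

lemma capacity_eps_antimono:
  assumes "\<epsilon> \<le> \<epsilon>'"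
  shows "capacity_eps f \<mu> p \<epsilon>' \<le> capacity_eps f \<mu> p \<epsilon>"
proof -
  have "achieves_E3 f \<mu> p \<epsilon> \<delta> \<gamma> \<Longrightarrow> achieves_E3 f \<mu> p \<epsilon>' \<delta> \<gamma>" for \<delta> \<gamma>
    unfolding achieves_E3_def using ennreal_leI[OF assms] by (blast intro: order_trans)
  then show ?thesis
    unfolding capacity_eps_def by (intro Inf_superset_mono) blast
qed

lemma tendsto_smallest_capacity:
  "(capacity_eps f \<mu> p \<longlongrightarrow> smallest_capacity f \<mu> p) (at_right 0)"
  and smallest_capacity_eq_SUP:
  "smallest_capacity f \<mu> p = (SUP \<epsilon>\<in>{0<..}. capacity_eps f \<mu> p \<epsilon>)"
proof -
  let ?S = "SUP \<epsilon>\<in>{0<..}. capacity_eps f \<mu> p \<epsilon>"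
  have lim: "(capacity_eps f \<mu> p \<longlongrightarrow> ?S) (at_right 0)"
  proof (rule increasing_tendsto)
    show "\<forall>\<^sub>F \<epsilon> in at_right 0. capacity_eps f \<mu> p \<epsilon> \<le> ?S"
      by (auto simp: eventually_at_filter intro!: always_eventually SUP_upper)
  next
    fix c assume "c < ?S"
    then obtain e where e: "e > 0" "c < capacity_eps f \<mu> p e"
      by (auto simp: less_SUP_iff)
    have "\<forall>\<^sub>F \<epsilon> in at_right 0. \<epsilon> < e"
      using e(1) by (auto simp: eventually_at_right_field)
    then show "\<forall>\<^sub>F \<epsilon> in at_right 0. c < capacity_eps f \<mu> p \<epsilon>"
      by eventually_elim (meson capacity_eps_antimono e(2) less_imp_le less_le_trans)
  qed
  then show "smallest_capacity f \<mu> p = ?S"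
    unfolding smallest_capacity_def by (intro tendsto_Lim) auto
  with lim show "(capacity_eps f \<mu> p \<longlongrightarrow> smallest_capacity f \<mu> p) (at_right 0)"
    by simp
qed

end

theory Submission
  imports Defs
begin

text \<open>Since the dynamics is deterministic, the initial state determines the itinerary of the whole
  trajectory through a partition into small sets, and while one block of length \<open>L\<close> unfolds the coder
  can transmit the itinerary of the next. With \<open>K > 2\<^sup>h\<close> symbols this succeeds with high
  probability: by ergodicity, \<open>K\<^sup>L\<close> itineraries of a suitable length \<open>L\<close> carry most of the mass.

  For the last claim let \<open>H\<^sub>n\<close> be the entropy of the itineraries of length \<open>n\<close>. As \<open>H\<^sub>n / n\<close> has a limit
  below \<open>log K\<close>, some increment \<open>H\<^sub>n\<^sub>+\<^sub>1 - H\<^sub>n\<close> is less than some \<open>c < log K\<close>. This increment is the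
  integral of the conditional information \<open>g\<close> of one symbol given the next \<open>n\<close>, and the maximal ergodic
  theorem bounds the Birkhoff sums of \<open>g - c\<close> uniformly in time with high probability. Hence a typical
  itinerary of length \<open>n + m\<close> has weight at least a constant times \<open>2\<^sup>-\<^sup>m\<^sup>c\<close> for the Markov measure with
  memory \<open>n\<close>, and there are at most a constant times \<open>2\<^sup>m\<^sup>c\<close> such words.\<close>

section \<open>Limits of subadditive sequences\<close>

text \<open>Fekete's lemma: the limit is the infimum of the ratios. Writing
  \<open>n = k * d + i\<close> with \<open>i < d\<close>, subadditivity bounds \<open>u n\<close> by
  \<open>k * u d\<close> plus a remainder that is at most a constant and vanishes after division by
  \<open>n\<close>.\<close>

lemma fekete_nonneg:
  fixes u :: "nat \<Rightarrow> real"
  assumes sub: "\<And>m n. u (m + n) \<le> u m + u n" and nonneg: "\<And>n. 0 \<le> u n"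
  shows "convergent (\<lambda>n. u n / real n)"
proof -
  define L where "L = (INF n\<in>{1..}. u n / real n)"
  have bdd: "bdd_below ((\<lambda>n. u n / real n) ` {1..})"
    by (rule bdd_belowI[where m = 0]) (auto intro!: divide_nonneg_nonneg nonneg)
  have lower: "L \<le> u n / real n" if "n \<ge> 1" for n
    unfolding L_def using that by (intro cINF_lower bdd) auto
  have mult: "u (k * d + i) \<le> real k * u d + u i" for k d i
  proof (induction k)
    case (Suc k)
    have "u (Suc k * d + i) \<le> u d + u (k * d + i)"
      using sub[of d "k * d + i"] by (simp add: algebra_simps)
    with Suc show ?case by (simp add: algebra_simps)
  qed simp
  have "(\<lambda>n. u n / real n) \<longlonglongrightarrow> L"
  proof (rule order_tendstoI)
    fix c assume "c < L"
    then show "\<forall>\<^sub>F n in sequentially. c < u n / real n"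
      using lower by (intro eventually_sequentiallyI[of 1]) (auto intro: less_le_trans)
  next
    fix c assume "L < c"
    then obtain d where d: "d \<ge> 1" "u d / real d < c"
      unfolding L_def using cINF_less_iff[OF _ bdd, of c] by auto
    define C where "C = (\<Sum>i<d. u i)"
    have C: "u i \<le> C" if "i < d" for i
      unfolding C_def using that by (intro member_le_sum nonneg) auto
    have "(\<lambda>n. C / real n) \<longlonglongrightarrow> 0" by (rule lim_const_over_n)
    then have "\<forall>\<^sub>F n in sequentially. C / real n < c - u d / real d"
      using d(2) by (intro order_tendstoD(2)) auto
    then show "\<forall>\<^sub>F n in sequentially. u n / real n < c"
      using eventually_gt_at_top[of 0]
    proof eventually_elim
      case (elim n)
      have "u n = u ((n div d) * d + n mod d)" by simp
      also have "\<dots> \<le> real (n div d) * u d + u (n mod d)" by (rule mult)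
      also have "\<dots> \<le> (real n / real d) * u d + C"
        using d(1) by (intro add_mono mult_right_mono C nonneg) (auto simp: of_nat_div_le_of_nat)
      finally have "u n / real n \<le> ((real n / real d) * u d + C) / real n"
        by (rule divide_right_mono) simp
      also have "\<dots> = u d / real d + C / real n"
        using elim by (simp add: add_divide_distrib)
      finally show ?case using elim by simp
    qed
  qed
  then show ?thesis by (rule convergentI)
qed

section \<open>Birkhoff sums and the maximal ergodic theorem\<close>

locale measure_preserving_map = prob_space M for M :: "'a measure" +
  fixes f :: "'a \<Rightarrow> 'a"
  assumes space_UNIV: "space M = UNIV"
    and measurable_f [measurable]: "f \<in> M \<rightarrow>\<^sub>M M"
    and distr_f: "distr M M f = M"
begin

lemma measurable_funpow [measurable]: "f ^^ n \<in> M \<rightarrow>\<^sub>M M"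
  by (rule measurable_compose_n) measurable

lemma distr_funpow: "distr M M (f ^^ n) = M"
proof (induction n)
  case 0
  show ?case by (simp add: distr_id2 id_def)
next
  case (Suc n)
  then show ?case
    by (metis distr_distr distr_f funpow.simps(2) measurable_f measurable_funpow)
qed

lemma prob_vimage_funpow: "A \<in> events \<Longrightarrow> prob ((f ^^ n) -` A) = prob A"
  using measure_distr[OF measurable_funpow, of A n] by (simp add: distr_funpow space_UNIV)

lemma expectation_funpow:
  fixes \<phi> :: "'a \<Rightarrow> real"
  assumes [measurable]: "\<phi> \<in> borel_measurable M"
  shows "expectation (\<lambda>x. \<phi> ((f ^^ n) x)) = expectation \<phi>"
  using integral_distr[OF measurable_funpow assms, of n] by (simp add: distr_funpow)

definition birkhoff_sum :: "('a \<Rightarrow> real) \<Rightarrow> nat \<Rightarrow> 'a \<Rightarrow> real" where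
  "birkhoff_sum \<phi> n x = (\<Sum>i<n. \<phi> ((f ^^ i) x))"

lemma birkhoff_sum_Suc: "birkhoff_sum \<phi> (Suc n) x = \<phi> x + birkhoff_sum \<phi> n (f x)"
  unfolding birkhoff_sum_def by (subst sum.lessThan_Suc_shift) (simp add: funpow_swap1)

lemma measurable_birkhoff_sum [measurable]:
  assumes [measurable]: "\<phi> \<in> borel_measurable M"
  shows "birkhoff_sum \<phi> n \<in> borel_measurable M"
  unfolding birkhoff_sum_def by measurable

text \<open>The maximum of the Birkhoff sums of lengths 0 to \<open>n\<close>; the empty sum makes
  it nonnegative.\<close>

primrec max_birkhoff_sum :: "('a \<Rightarrow> real) \<Rightarrow> nat \<Rightarrow> 'a \<Rightarrow> real" where
  "max_birkhoff_sum \<phi> 0 x = 0"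
| "max_birkhoff_sum \<phi> (Suc n) x = max 0 (\<phi> x + max_birkhoff_sum \<phi> n (f x))"

lemma birkhoff_sum_le_max: "k \<le> n \<Longrightarrow> birkhoff_sum \<phi> k x \<le> max_birkhoff_sum \<phi> n x"
proof (induction n arbitrary: k x)
  case (Suc n)
  then show ?case
    by (cases k) (auto simp: birkhoff_sum_Suc le_max_iff_disj birkhoff_sum_def[of _ 0])
qed (simp add: birkhoff_sum_def)

lemma max_birkhoff_sum_Suc_ge: "max_birkhoff_sum \<phi> n x \<le> max_birkhoff_sum \<phi> (Suc n) x"
  by (induction n arbitrary: x) (auto simp: max.coboundedI2 intro: max.mono)

lemma max_birkhoff_sum_bound:
  assumes "\<And>x. \<bar>\<phi> x\<bar> \<le> B"
  shows "\<bar>max_birkhoff_sum \<phi> n x\<bar> \<le> real n * B"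
proof (induction n arbitrary: x)
  case (Suc n)
  have "0 \<le> B" using assms[of x] by linarith
  then show ?case
    using assms[of x] Suc[of "f x"] by (auto simp: algebra_simps max_def abs_le_iff)
qed simp

lemma measurable_max_birkhoff_sum [measurable]:
  assumes [measurable]: "\<phi> \<in> borel_measurable M"
  shows "max_birkhoff_sum \<phi> n \<in> borel_measurable M"
  by (induction n) auto

text \<open>Garsia's argument: where the maximum \<open>m\<close> is positive, \<open>m \<le> \<phi> + m \<circ> f\<close>.\<close>

lemma maximal_ergodic:
  assumes [measurable]: "\<phi> \<in> borel_measurable M" and B: "\<And>x. \<bar>\<phi> x\<bar> \<le> B"
  shows "- B * prob {x. max_birkhoff_sum \<phi> (Suc n) x \<le> 0} \<le> expectation \<phi>"
proof -
  note max_birkhoff_sum.simps [simp del]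
  let ?m = "max_birkhoff_sum \<phi> (Suc n)"
  let ?E = "{x. ?m x \<le> 0}"
  have E_events [measurable]: "?E \<in> events"
    using measurable_sets_Collect[of ?m M borel "\<lambda>y. y \<le> 0"] by (simp add: space_UNIV)
  have B0: "0 \<le> B" using B[of undefined] by linarith
  have int_m: "integrable M ?m"
    using max_birkhoff_sum_bound[of \<phi>, OF B]
    by (intro integrable_const_bound[where B = "real (Suc n) * B"]) (auto intro!: AE_I2 simp del: of_nat_Suc)
  have int_mf: "integrable M (\<lambda>x. ?m (f x))"
    using max_birkhoff_sum_bound[of \<phi>, OF B]
    by (intro integrable_const_bound[where B = "real (Suc n) * B"]) (auto intro!: AE_I2 simp del: of_nat_Suc)
  have int_\<phi>: "integrable M \<phi>"
    using B by (intro integrable_const_bound[where B = B]) auto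
  have int_E: "integrable M (indicator ?E :: 'a \<Rightarrow> real)"
    by (rule integrable_real_indicator[OF E_events])
      (simp only: emeasure_eq_measure infinity_ennreal_def ennreal_less_top)
  \<comment> \<open>Where the maximum vanishes, \<open>B\<close> compensates for a negative
    \<open>\<phi> x\<close>. After integration the means of \<open>?m\<close> and \<open>?m\<close>
    after \<open>f\<close> cancel by invariance.\<close>
  have pointwise: "?m x \<le> \<phi> x + B * indicator ?E x + ?m (f x)" for x
  proof (cases "x \<in> ?E")
    case True
    moreover have "0 \<le> ?m (f x)" by (simp add: max_birkhoff_sum.simps)
    ultimately show ?thesis using B[of x] by simp
  next
    case False
    then show ?thesis using max_birkhoff_sum_Suc_ge[of \<phi> n "f x"] by (auto simp: max_birkhoff_sum.simps(2)[of _ _ x] max_def)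
  qed
  have int_sum: "integrable M (\<lambda>x. \<phi> x + B * indicator ?E x)"
    using int_\<phi> integrable_mult_right[OF int_E] by (rule Bochner_Integration.integrable_add)
  have "expectation ?m \<le> expectation (\<lambda>x. \<phi> x + B * indicator ?E x + ?m (f x))"
    using int_m Bochner_Integration.integrable_add[OF int_sum int_mf] pointwise by (rule integral_mono)
  also have "\<dots> = expectation (\<lambda>x. \<phi> x + B * indicator ?E x) + expectation (\<lambda>x. ?m (f x))"
    by (rule Bochner_Integration.integral_add[OF int_sum int_mf])
  also have "expectation (\<lambda>x. \<phi> x + B * indicator ?E x)
      = expectation \<phi> + expectation (\<lambda>x. B * indicator ?E x)"
    by (rule Bochner_Integration.integral_add[OF int_\<phi> integrable_mult_right[OF int_E]])
  also have "expectation (\<lambda>x. B * indicator ?E x) = B * prob ?E"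
    by (simp add: space_UNIV del: max_birkhoff_sum.simps)
  also have "expectation (\<lambda>x. ?m (f x)) = expectation ?m"
    using expectation_funpow[of ?m 1] by simp
  finally show ?thesis by simp
qed

text \<open>The points at which the Birkhoff sums are unbounded above form a strictly invariant set, so no
  null-set modification is needed before applying ergodicity.\<close>

lemma birkhoff_sum_bounded_above:
  assumes ergodic: "\<And>A. A \<in> events \<Longrightarrow> f -` A = A \<Longrightarrow> prob A = 0 \<or> prob A = 1"
    and [measurable]: "\<phi> \<in> borel_measurable M" and B: "\<And>x. \<bar>\<phi> x\<bar> \<le> B"
    and neg: "expectation \<phi> < 0" and "\<eta> > 0"
  shows "\<exists>k. prob {x. \<exists>n. birkhoff_sum \<phi> n x > real k} < \<eta>"
proof -
  let ?S = "birkhoff_sum \<phi>"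
  define A where "A k = {x. \<exists>n. ?S n x > real k}" for k
  have A_events [measurable]: "A k \<in> events" for k
  proof -
    have "{x \<in> space M. \<exists>n. ?S n x > real k} \<in> events" by measurable
    then show ?thesis by (simp add: A_def space_UNIV)
  qed
  have A_dec: "decseq A"
    unfolding decseq_def A_def using of_nat_le_iff order_le_less_trans by blast
  \<comment> \<open>Moving the start from \<open>x\<close> to \<open>f x\<close> removes the single
    term \<open>\<phi> x\<close>, at most \<open>B\<close> in modulus, so the sums are unbounded
    above at both points or at neither.\<close>
  have "x \<in> (\<Inter>k. A k) \<longleftrightarrow> f x \<in> (\<Inter>k. A k)" for x
  proof
    assume x: "x \<in> (\<Inter>k. A k)"
    show "f x \<in> (\<Inter>k. A k)"
    proof
      fix k
      obtain j where j: "real j \<ge> real k + B" using real_arch_simple by blast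
      obtain n where n: "?S n x > real j" using x by (auto simp: A_def)
      have "n \<noteq> 0" using n by (auto simp: birkhoff_sum_def intro: gr0I)
      then obtain m where "n = Suc m" using not0_implies_Suc by blast
      with n j B[of x] have "?S m (f x) > real k" by (simp add: birkhoff_sum_Suc)
      then show "f x \<in> A k" by (auto simp: A_def)
    qed
  next
    assume x: "f x \<in> (\<Inter>k. A k)"
    show "x \<in> (\<Inter>k. A k)"
    proof
      fix k
      obtain j where j: "real j \<ge> real k + B" using real_arch_simple by blast
      obtain n where "?S n (f x) > real j" using x by (auto simp: A_def)
      with j B[of x] have "?S (Suc n) x > real k" by (simp add: birkhoff_sum_Suc)
      then show "x \<in> A k" unfolding A_def by blast
    qed
  qed
  then have inv: "f -` (\<Inter>k. A k) = (\<Inter>k. A k)" by blast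
  \<comment> \<open>If almost every point had unbounded sums, the sets \<open>Z n\<close> would
    shrink to a null set, and the maximal inequality would give a nonnegative mean in the
    limit.\<close>
  have "prob (\<Inter>k. A k) \<noteq> 1"
  proof
    assume full: "prob (\<Inter>k. A k) = 1"
    define Z where "Z n = {x. max_birkhoff_sum \<phi> n x \<le> 0}" for n
    have [measurable]: "Z n \<in> events" for n
      using measurable_sets_Collect[of "max_birkhoff_sum \<phi> n" M borel "\<lambda>y. y \<le> 0"]
      by (simp add: space_UNIV Z_def)
    have "decseq Z"
      unfolding Z_def decseq_Suc_iff using max_birkhoff_sum_Suc_ge order_trans by blast
    then have "(\<lambda>n. prob (Z n)) \<longlonglongrightarrow> prob (\<Inter>n. Z n)"
      by (intro finite_Lim_measure_decseq) auto
    moreover have "(\<Inter>n. Z n) \<subseteq> space M - (\<Inter>k. A k)"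
    proof
      fix x assume x: "x \<in> (\<Inter>n. Z n)"
      have "?S n x \<le> 0" for n
        using birkhoff_sum_le_max[of n n \<phi> x] x by (fastforce simp: Z_def intro: order_trans)
      then have "x \<notin> A 0" by (auto simp: A_def not_less)
      then show "x \<in> space M - (\<Inter>k. A k)" by (auto simp: space_UNIV)
    qed
    then have "prob (\<Inter>n. Z n) \<le> prob (space M - (\<Inter>k. A k))"
      by (intro finite_measure_mono) auto
    then have "prob (\<Inter>n. Z n) = 0"
      using full by (simp add: prob_compl measure_le_0_iff)
    ultimately have "(\<lambda>n. prob (Z (Suc n))) \<longlonglongrightarrow> 0" by (intro LIMSEQ_Suc) simp
    then have "(\<lambda>n. - B * prob (Z (Suc n))) \<longlonglongrightarrow> - B * 0"
      by (intro tendsto_intros)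
    then have "- B * 0 \<le> expectation \<phi>"
      by (rule LIMSEQ_le_const2) (use maximal_ergodic[OF assms(2) B] in \<open>auto simp: Z_def\<close>)
    with neg show False by simp
  qed
  with ergodic[OF _ inv] have "prob (\<Inter>k. A k) = 0" by auto
  moreover have "(\<lambda>k. prob (A k)) \<longlonglongrightarrow> prob (\<Inter>k. A k)"
    by (intro finite_Lim_measure_decseq A_dec) auto
  ultimately have "\<forall>\<^sub>F k in sequentially. prob (A k) < \<eta>"
    using \<open>\<eta> > 0\<close> by (intro order_tendstoD(2)) auto
  then show ?thesis by (auto simp: eventually_sequentially A_def)
qed

end

section \<open>Itineraries, cylinders and their probabilities\<close>

locale labelled_map = measure_preserving_map +
  fixes a :: "'a \<Rightarrow> nat" and r :: nat
  assumes measurable_label [measurable]: "a \<in> M \<rightarrow>\<^sub>M count_space UNIV"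
    and label_less: "a x < r"
begin

text \<open>The itinerary of \<open>x\<close> through the partition into the fibres of
  \<open>a\<close>.\<close>

primrec name :: "nat \<Rightarrow> 'a \<Rightarrow> nat list" where
  "name 0 x = []"
| "name (Suc n) x = a x # name n (f x)"

lemma length_name [simp]: "length (name n x) = n"
  by (induction n arbitrary: x) auto

lemma nth_name: "i < n \<Longrightarrow> name n x ! i = a ((f ^^ i) x)"
proof (induction n arbitrary: i x)
  case (Suc n)
  then show ?case by (cases i) (auto simp: funpow_swap1)
qed simp

lemma name_add: "name (n + m) x = name n x @ name m ((f ^^ n) x)"
  by (induction n arbitrary: x) (auto simp: funpow_swap1)

lemma take_name [simp]: "take n (name (n + m) x) = name n x"
  by (simp add: name_add)

lemma drop_name [simp]: "drop n (name (n + m) x) = name m ((f ^^ n) x)"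
  by (simp add: name_add)

lemma measurable_name [measurable]: "name n \<in> M \<rightarrow>\<^sub>M count_space UNIV"
proof (induction n)
  case 0
  have "name 0 = (\<lambda>_. [])" by auto
  then show ?case by simp
next
  case (Suc n)
  then have [measurable]: "name n \<in> M \<rightarrow>\<^sub>M count_space UNIV" .
  have "name (Suc n) = (\<lambda>x. a x # name n (f x))" by auto
  then show ?case by simp
qed

definition words :: "nat \<Rightarrow> nat list set" where
  "words n = {w. set w \<subseteq> {..<r} \<and> length w = n}"

lemma finite_words [simp]: "finite (words n)"
  unfolding words_def by (rule finite_lists_length_eq) simp

lemma length_words: "w \<in> words n \<Longrightarrow> length w = n"
  by (simp add: words_def)

lemma name_in_words [simp]: "name n x \<in> words n"
  by (auto simp: words_def in_set_conv_nth nth_name label_less)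

lemma bij_betw_append_words: "bij_betw (\<lambda>(u, v). u @ v) (words n \<times> words m) (words (n + m))"
  by (rule bij_betw_byWitness[where f' = "\<lambda>w. (take n w, drop n w)"])
    (auto simp: words_def dest: in_set_takeD in_set_dropD)

lemma bij_betw_Cons_words: "bij_betw (\<lambda>(b, w). b # w) ({..<r} \<times> words n) (words (Suc n))"
  by (rule bij_betw_byWitness[where f' = "\<lambda>w. (hd w, tl w)"])
    (auto simp: words_def length_Suc_conv)

definition cylinder :: "nat list \<Rightarrow> 'a set" where
  "cylinder w = {x. name (length w) x = w}"

definition cyl_prob :: "nat list \<Rightarrow> real" where
  "cyl_prob w = prob (cylinder w)"

lemma Collect_name_events [measurable]: "{x. Q (name n x)} \<in> events"
proof -
  have "{x \<in> space M. Q (name n x)} \<in> events" by measurable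
  then show ?thesis by (simp add: space_UNIV)
qed

lemma cylinder_events [measurable]: "cylinder w \<in> events"
  unfolding cylinder_def by measurable

lemma cyl_prob_nonneg [simp]: "0 \<le> cyl_prob w"
  by (simp add: cyl_prob_def)

lemma cyl_prob_le_1: "cyl_prob w \<le> 1"
  by (simp add: cyl_prob_def)

text \<open>A function of the first \<open>n\<close> labels is a finite combination of indicators of
  cylinders, so its mean is a sum over words.\<close>

lemma expectation_name:
  fixes h :: "nat list \<Rightarrow> real"
  shows "expectation (\<lambda>x. h (name n x)) = (\<Sum>w\<in>words n. cyl_prob w * h w)"
proof -
  have "h (name n x) = (\<Sum>w\<in>words n. indicator (cylinder w) x * h w)" for x
  proof -
    have "(\<Sum>w\<in>words n. indicator (cylinder w) x * h w)
        = (\<Sum>w\<in>words n. if w = name n x then h w else 0)"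
      by (intro sum.cong) (auto simp: cylinder_def length_words indicator_def)
    then show ?thesis by simp
  qed
  then have "expectation (\<lambda>x. h (name n x))
      = expectation (\<lambda>x. \<Sum>w\<in>words n. indicator (cylinder w) x * h w)"
    by (rule arg_cong[where f = expectation, OF ext])
  also have "\<dots> = (\<Sum>w\<in>words n. expectation (\<lambda>x. indicator (cylinder w) x * h w))"
  proof (rule Bochner_Integration.integral_sum)
    fix w assume "w \<in> words n"
    show "integrable M (\<lambda>x. indicator (cylinder w) x * h w)"
      by (intro integrable_mult_left integrable_const_bound[where B = 1]) auto
  qed
  finally show ?thesis by (simp add: cyl_prob_def)
qed

lemma integrable_name:
  fixes h :: "nat list \<Rightarrow> real"
  shows "integrable M (\<lambda>x. h (name n x))"
proof (rule integrable_const_bound)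
  show "AE x in M. norm (h (name n x)) \<le> (\<Sum>w\<in>words n. \<bar>h w\<bar>)"
    by (intro AE_I2) (auto intro: member_le_sum)
qed measurable

lemma sum_cyl_prob: "(\<Sum>w\<in>words n. cyl_prob w) = 1"
  using expectation_name[of "\<lambda>_. 1" n] by (simp add: prob_space)

text \<open>The cylinders of the words \<open>b # u\<close> partition the preimage under
  \<open>f\<close> of the cylinder of \<open>u\<close>; invariance does the rest.\<close>

lemma sum_cyl_prob_Cons: "(\<Sum>b<r. cyl_prob (b # u)) = cyl_prob u"
proof -
  have "prob (f -` cylinder u) = (\<Sum>b<r. prob (cylinder (b # u)))"
  proof (subst finite_measure_finite_Union[symmetric])
    show "disjoint_family_on (\<lambda>b. cylinder (b # u)) {..<r}"
      by (auto simp: disjoint_family_on_def cylinder_def)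
    show "prob (f -` cylinder u) = prob (\<Union>b<r. cylinder (b # u))"
      by (rule arg_cong[where f = prob]) (auto simp: cylinder_def label_less)
  qed auto
  then show ?thesis
    using prob_vimage_funpow[of "cylinder u" 1] by (simp add: cyl_prob_def)
qed

lemma cyl_prob_take: "cyl_prob w \<le> cyl_prob (take n w)"
  unfolding cyl_prob_def
proof (intro finite_measure_mono subsetI)
  fix x assume "x \<in> cylinder w"
  then show "x \<in> cylinder (take n w)"
    using take_name[of "min n (length w)" "length w - n" x]
    by (cases "n \<le> length w") (auto simp: cylinder_def)
qed auto

lemma cyl_prob_drop: "cyl_prob w \<le> cyl_prob (drop n w)"
proof -
  have "cyl_prob w \<le> prob ((f ^^ n) -` cylinder (drop n w))"
    unfolding cyl_prob_def
  proof (intro finite_measure_mono subsetI)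
    fix x assume x: "x \<in> cylinder w"
    show "x \<in> (f ^^ n) -` cylinder (drop n w)"
      using x drop_name[of n "length w - n" x]
      by (cases "n \<le> length w") (auto simp: cylinder_def)
  next
    show "(f ^^ n) -` cylinder (drop n w) \<in> events"
      using measurable_sets[OF measurable_funpow cylinder_events, of n] by (simp add: space_UNIV)
  qed
  then show ?thesis by (simp add: prob_vimage_funpow cyl_prob_def)
qed

text \<open>The finitely many words of probability zero together describe a null set, and its
  preimages are null by invariance. Almost everywhere, logarithms and quotients of cylinder
  probabilities are therefore genuine.\<close>

lemma AE_cyl_prob_pos: "AE x in M. \<forall>i. cyl_prob (name n ((f ^^ i) x)) > 0"
proof (subst AE_all_countable, rule allI)
  fix i
  let ?N = "{x. cyl_prob (name n x) = 0}"
  have "(\<lambda>x. indicator {w. cyl_prob w = 0} (name n x) :: real) = indicator ?N"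
    by (auto simp: indicator_def)
  then have "prob ?N = expectation (\<lambda>x. indicator {w. cyl_prob w = 0} (name n x))"
    by (simp only: Bochner_Integration.integral_indicator space_UNIV Int_UNIV_right)
  also have "\<dots> = 0"
    unfolding expectation_name by (intro sum.neutral ballI) (simp split: split_indicator)
  finally have "prob ((f ^^ i) -` ?N) = 0"
    using prob_vimage_funpow[OF Collect_name_events[of "\<lambda>w. cyl_prob w = 0" n], of i]
    by (simp only:)
  moreover have "(f ^^ i) -` ?N \<in> events"
    using measurable_sets[OF measurable_funpow, of ?N i] by (simp add: space_UNIV)
  ultimately have "AE x in M. x \<notin> (f ^^ i) -` ?N"
    by (simp add: prob_eq_0)
  then show "AE x in M. cyl_prob (name n ((f ^^ i) x)) > 0"
    by eventually_elim (use cyl_prob_nonneg less_eq_real_def in auto)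
qed

lemma AE_all_cyl_prob_pos: "AE x in M. \<forall>n i. cyl_prob (name n ((f ^^ i) x)) > 0"
  by (subst AE_all_countable) (intro allI AE_cyl_prob_pos)

section \<open>Entropy of itineraries\<close>

definition block_entropy :: "nat \<Rightarrow> real" where
  "block_entropy n = (\<Sum>w\<in>words n. cyl_prob w * - log 2 (cyl_prob w))"

text \<open>Invariance makes the shift \<open>i\<close> free. It serves to read the entropy off a
  later stretch of the same orbit.\<close>

lemma block_entropy_eq_expectation:
  "block_entropy n = expectation (\<lambda>x. - log 2 (cyl_prob (name n ((f ^^ i) x))))"
  using expectation_funpow[of "\<lambda>x. - log 2 (cyl_prob (name n x))" i]
    expectation_name[of "\<lambda>w. - log 2 (cyl_prob w)" n]
  unfolding block_entropy_def by simp

lemma block_entropy_nonneg: "0 \<le> block_entropy n"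
  unfolding block_entropy_def
proof (rule sum_nonneg)
  fix w
  show "0 \<le> cyl_prob w * - log 2 (cyl_prob w)"
  proof (cases "cyl_prob w = 0")
    case False
    then have "cyl_prob w > 0" using cyl_prob_nonneg less_eq_real_def by auto
    then show ?thesis using cyl_prob_le_1[of w] by (simp add: mult_nonneg_nonpos)
  qed simp
qed

text \<open>Mutual information is nonnegative: the joint law of prefix and suffix is compared with
  the product of their laws by \<open>ln t \<le> t - 1\<close>, and both laws have total mass
  1.\<close>

lemma block_entropy_subadditive: "block_entropy (n + m) \<le> block_entropy n + block_entropy m"
proof -
  let ?p = cyl_prob and ?\<psi> = "\<lambda>w. log 2 (cyl_prob (take n w)) + log 2 (cyl_prob (drop n w))"
  have "integrable M (\<lambda>x. log 2 (?p (name m ((f ^^ n) x))))"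
    using integrable_name[of "\<lambda>w. log 2 (?p (drop n w))" "n + m"] by simp
  moreover have "integrable M (\<lambda>x. log 2 (?p (name n x)))"
    by (rule integrable_name)
  ultimately have E: "expectation (\<lambda>x. ?\<psi> (name (n + m) x)) = - (block_entropy n + block_entropy m)"
    using block_entropy_eq_expectation[of n 0] block_entropy_eq_expectation[of m n] by simp
  have eq: "- (block_entropy n + block_entropy m) = (\<Sum>w\<in>words (n + m). ?p w * ?\<psi> w)"
    by (rule trans[OF E[symmetric] expectation_name[of ?\<psi>]])
  have "?p w * (?\<psi> w - log 2 (?p w)) \<le> (?p (take n w) * ?p (drop n w) - ?p w) / ln 2" for w
  proof (cases "?p w = 0")
    case False
    then have P: "?p w > 0" using cyl_prob_nonneg less_eq_real_def by auto
    then have Q: "?p (take n w) > 0" "?p (drop n w) > 0"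
      using cyl_prob_take cyl_prob_drop less_le_trans by blast+
    have "?p w * ln (?p (take n w) * ?p (drop n w) / ?p w)
        \<le> ?p w * (?p (take n w) * ?p (drop n w) / ?p w - 1)"
      using P Q by (intro mult_left_mono ln_le_minus_one) auto
    also have "\<dots> = ?p (take n w) * ?p (drop n w) - ?p w"
      using P by (simp add: field_simps)
    finally have "?p w * ln (?p (take n w) * ?p (drop n w) / ?p w) / ln 2
        \<le> (?p (take n w) * ?p (drop n w) - ?p w) / ln 2"
      by (rule divide_right_mono) simp
    moreover have "?\<psi> w - log 2 (?p w) = ln (?p (take n w) * ?p (drop n w) / ?p w) / ln 2"
      using P Q by (simp add: log_def ln_mult ln_div add_divide_distrib diff_divide_distrib)
    ultimately show ?thesis by simp
  qed simp
  then have "(\<Sum>w\<in>words (n + m). ?p w * (?\<psi> w - log 2 (?p w)))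
      \<le> (\<Sum>w\<in>words (n + m). (?p (take n w) * ?p (drop n w) - ?p w) / ln 2)"
    by (intro sum_mono)
  also have "\<dots> = ((\<Sum>w\<in>words (n + m). ?p (take n w) * ?p (drop n w)) - 1) / ln 2"
    by (simp add: sum_divide_distrib[symmetric] sum_subtractf sum_cyl_prob)
  also have "(\<Sum>w\<in>words (n + m). ?p (take n w) * ?p (drop n w))
      = (\<Sum>(u, v)\<in>words n \<times> words m. ?p u * ?p v)"
    by (subst sum.reindex_bij_betw[OF bij_betw_append_words, symmetric])
      (auto intro!: sum.cong simp: length_words)
  also have "\<dots> = 1"
    by (simp add: sum.cartesian_product[symmetric] sum_distrib_left[symmetric]
        sum_cyl_prob)
  finally show ?thesis
    using eq by (simp add: right_diff_distrib sum_subtractf block_entropy_def sum_negf)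
qed

section \<open>Markov weights and conditional information\<close>

text \<open>The Markov measure of memory \<open>n\<close>, run backwards in time so that the recursion peels off the
  first letter.\<close>

primrec weight :: "nat \<Rightarrow> nat \<Rightarrow> nat list \<Rightarrow> real" where
  "weight n 0 w = cyl_prob w"
| "weight n (Suc m) w = cyl_prob (take (Suc n) w) / cyl_prob (take n (tl w)) * weight n m (tl w)"

lemma weight_nonneg: "0 \<le> weight n m w"
  by (induction m arbitrary: w) auto

text \<open>Summing over the first letter turns the transition factor into \<open>p / p\<close>,
  which is 1, or 0 when \<open>p = 0\<close> because division by zero gives 0.\<close>

lemma sum_weight_le_1: "(\<Sum>w\<in>words (n + m). weight n m w) \<le> 1"
proof (induction m)
  case 0
  show ?case by (simp add: sum_cyl_prob)
next
  case (Suc m)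
  have "(\<Sum>w\<in>words (n + Suc m). weight n (Suc m) w)
      = (\<Sum>(b, w)\<in>{..<r} \<times> words (n + m). cyl_prob (b # take n w) / cyl_prob (take n w) * weight n m w)"
    unfolding add_Suc_right
    by (subst sum.reindex_bij_betw[OF bij_betw_Cons_words, symmetric]) (auto intro!: sum.cong)
  also have "\<dots> = (\<Sum>w\<in>words (n + m). \<Sum>b<r. cyl_prob (b # take n w) / cyl_prob (take n w) * weight n m w)"
    by (subst sum.cartesian_product[symmetric], rule sum.swap)
  also have "\<dots> = (\<Sum>w\<in>words (n + m). cyl_prob (take n w) / cyl_prob (take n w) * weight n m w)"
    by (simp only: sum_distrib_right[symmetric] sum_divide_distrib[symmetric] sum_cyl_prob_Cons)
  also have "\<dots> \<le> (\<Sum>w\<in>words (n + m). weight n m w)"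
    by (intro sum_mono) (auto simp: weight_nonneg)
  finally show ?case using Suc by linarith
qed

text \<open>Minus the logarithm of the conditional probability of the first letter given the
  \<open>n\<close> letters after it; conditioning on the future matches the recursion of
  \<open>weight\<close>.\<close>

definition conditional_information :: "nat \<Rightarrow> 'a \<Rightarrow> real" where
  "conditional_information n x = log 2 (cyl_prob (name n (f x))) - log 2 (cyl_prob (name (Suc n) x))"

lemma conditional_information_eq_name:
  "conditional_information n x = log 2 (cyl_prob (tl (name (Suc n) x))) - log 2 (cyl_prob (name (Suc n) x))"
  by (simp add: conditional_information_def)

text \<open>The chain rule for entropy, with invariance removing the shift in the first
  term.\<close>

lemma expectation_conditional_information:
  "expectation (conditional_information n) = block_entropy (Suc n) - block_entropy n"
proof -
  have "integrable M (\<lambda>x. log 2 (cyl_prob (name n (f x))))"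
    using integrable_name[of "\<lambda>w. log 2 (cyl_prob (tl w))" "Suc n"] by simp
  moreover have "integrable M (\<lambda>x. log 2 (cyl_prob (name (Suc n) x)))"
    by (rule integrable_name)
  ultimately show ?thesis
    using block_entropy_eq_expectation[of n 1] block_entropy_eq_expectation[of "Suc n" 0]
    unfolding conditional_information_def by (simp del: name.simps)
qed

text \<open>Each transition factor along the orbit is 2 to the minus conditional information, so
  their product is governed by a Birkhoff sum. The remaining factor is the probability of the last
  \<open>n\<close> letters.\<close>

lemma weight_name:
  assumes "\<And>i k. cyl_prob (name k ((f ^^ i) x)) > 0"
  shows "weight n m (name (n + m) x) =
    cyl_prob (name n ((f ^^ m) x)) * 2 powr (- birkhoff_sum (conditional_information n) m x)"
  using assms
proof (induction m arbitrary: x)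
  case 0
  then show ?case by (simp add: birkhoff_sum_def)
next
  case (Suc m)
  have pos: "cyl_prob (name k ((f ^^ i) (f x))) > 0" for i k
    using Suc.prems[of k "Suc i"] by (simp add: funpow_swap1)
  have "take (Suc n) (name (n + Suc m) x) = name (Suc n) x"
    using take_name[of "Suc n" m x] by simp
  then have "weight n (Suc m) (name (n + Suc m) x) =
      cyl_prob (name (Suc n) x) / cyl_prob (name n (f x)) * weight n m (name (n + m) (f x))"
    by simp
  also have "cyl_prob (name (Suc n) x) / cyl_prob (name n (f x)) = 2 powr (- conditional_information n x)"
    using pos[of n 0] Suc.prems[of "Suc n" 0]
    by (simp add: conditional_information_def powr_diff del: name.simps)
  finally show ?case
    unfolding Suc.IH[OF pos] birkhoff_sum_Suc
    by (simp add: powr_add[symmetric] funpow_swap1 powr_diff powr_minus divide_simps)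
qed


section \<open>Counting typical words\<close>

text \<open>A counting form of the Shannon-McMillan theorem for one suitable length, which suffices
  for a code that works in blocks of that length.\<close>

lemma few_words_carry_most_mass:
  assumes ergodic: "\<And>A. A \<in> events \<Longrightarrow> f -` A = A \<Longrightarrow> prob A = 0 \<or> prob A = 1"
    and lim: "(\<lambda>n. block_entropy n / real n) \<longlonglongrightarrow> h"
    and K: "h < log 2 (real K)" "K > 0" and "\<eta> > 0"
  shows "\<exists>L W. L > 0 \<and> W \<subseteq> words L \<and> card W \<le> K ^ L \<and> prob {x. name L x \<notin> W} < \<eta>"
proof -
  obtain c where c: "h < c" "c < log 2 (real K)" using K dense by blast
  \<comment> \<open>Otherwise the increments add up to at least \<open>n * c\<close>, which forces
    \<open>c \<le> h\<close>.\<close>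
  have "\<exists>n. block_entropy (Suc n) - block_entropy n < c"
  proof (rule ccontr)
    assume contra: "\<not> ?thesis"
    have "real n * c \<le> block_entropy n" for n
    proof (induction n)
      case (Suc n)
      have "c \<le> block_entropy (Suc n) - block_entropy n" using contra not_less by blast
      with Suc show ?case by (simp add: algebra_simps)
    qed (simp add: block_entropy_nonneg)
    then have "c \<le> block_entropy n / real n" if "n \<ge> 1" for n
      using that by (simp add: field_simps)
    with lim have "c \<le> h" by (intro LIMSEQ_le_const) auto
    with c show False by simp
  qed
  then obtain n where n: "block_entropy (Suc n) - block_entropy n < c" ..
  let ?g = "conditional_information n"
  define \<phi> where "\<phi> x = ?g x - c" for x
  have g_meas [measurable]: "?g \<in> borel_measurable M"
    unfolding conditional_information_def by measurable
  then have [measurable]: "\<phi> \<in> borel_measurable M" unfolding \<phi>_def by measurable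
  \<comment> \<open>The conditional information depends only on the name of length
    \<open>Suc n\<close>, so a sum over all such words bounds it everywhere.\<close>
  define B where "B = (\<Sum>w\<in>words (Suc n). \<bar>log 2 (cyl_prob (tl w)) - log 2 (cyl_prob w)\<bar>)"
  have g_bound: "\<bar>?g x\<bar> \<le> B" for x
    unfolding conditional_information_eq_name B_def
    by (rule member_le_sum[where f = "\<lambda>w. \<bar>log 2 (cyl_prob (tl w)) - log 2 (cyl_prob w)\<bar>"])
      (auto simp del: name.simps)
  have \<phi>_bound: "\<bar>\<phi> x\<bar> \<le> B + \<bar>c\<bar>" for x
    using g_bound[of x] unfolding \<phi>_def by linarith
  have "integrable M ?g"
    by (rule integrable_const_bound[where B = B]) (auto simp: g_bound)
  then have "expectation \<phi> < 0"
    using n by (simp add: \<phi>_def[abs_def] expectation_conditional_information prob_space)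
  then obtain k where k: "prob {x. \<exists>m. birkhoff_sum \<phi> m x > real k} < \<eta>"
    using birkhoff_sum_bounded_above[of \<phi> "B + \<bar>c\<bar>" \<eta>, OF ergodic _ \<phi>_bound _ \<open>\<eta> > 0\<close>]
    by auto
  \<comment> \<open>The least positive probability of a word of length \<open>n\<close>, capped at
    1; inserting 1 keeps the set nonempty.\<close>
  define \<delta> where "\<delta> = Min (insert 1 (cyl_prob ` words n - {0}))"
  have \<delta>: "\<delta> > 0" "\<And>w. w \<in> words n \<Longrightarrow> cyl_prob w > 0 \<Longrightarrow> \<delta> \<le> cyl_prob w"
  proof -
    show "\<delta> > 0"
      unfolding \<delta>_def by (subst Min_gr_iff) (auto simp: order_less_le)
    show "\<delta> \<le> cyl_prob w" if "w \<in> words n" "cyl_prob w > 0" for w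
      unfolding \<delta>_def using that by (intro Min_le) auto
  qed
  \<comment> \<open>The threshold is the value of \<open>weight_name\<close> when the last
    \<open>n\<close> letters have probability \<open>\<delta>\<close> and the Birkhoff sum of
    \<open>?g\<close> equals \<open>m * c + k\<close>. As the weights sum to at most 1, few words
    reach it.\<close>
  define W where "W m = {w \<in> words (n + m). \<delta> * 2 powr (- (real m * c) - real k) \<le> weight n m w}" for m
  have card_W: "real (card (W m)) \<le> 2 powr (real m * c + real k) / \<delta>" for m
  proof -
    have "real (card (W m)) * (\<delta> * 2 powr (- (real m * c) - real k)) \<le> (\<Sum>w\<in>W m. weight n m w)"
      by (rule sum_bounded_below) (simp add: W_def)
    also have "\<dots> \<le> (\<Sum>w\<in>words (n + m). weight n m w)"
      by (rule sum_mono2) (auto simp: W_def weight_nonneg)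
    also have "\<dots> \<le> 1" by (rule sum_weight_le_1)
    finally show ?thesis
      using \<delta>(1) by (simp add: powr_diff powr_minus powr_add divide_simps mult_ac)
  qed
  have "prob {x. name (n + m) x \<notin> W m} < \<eta>" for m
  proof -
    have "AE x in M. x \<in> {x. name (n + m) x \<notin> W m} \<longrightarrow> x \<in> {x. \<exists>m. birkhoff_sum \<phi> m x > real k}"
      using AE_all_cyl_prob_pos
    proof eventually_elim
      case (elim x)
      show ?case
      proof (rule impI, rule ccontr)
        assume "x \<in> {x. name (n + m) x \<notin> W m}" and "x \<notin> {x. \<exists>m. birkhoff_sum \<phi> m x > real k}"
        then have notin: "name (n + m) x \<notin> W m" and le: "birkhoff_sum \<phi> m x \<le> real k"
          by (auto simp: not_less)
        have "birkhoff_sum \<phi> m x = birkhoff_sum ?g m x - real m * c"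
          by (simp add: birkhoff_sum_def \<phi>_def sum_subtractf)
        with le have "- (real m * c) - real k \<le> - birkhoff_sum ?g m x" by simp
        then have "\<delta> * 2 powr (- (real m * c) - real k)
            \<le> cyl_prob (name n ((f ^^ m) x)) * 2 powr (- birkhoff_sum ?g m x)"
          using elim \<delta>(1) by (intro mult_mono \<delta>(2)) auto
        also have "\<dots> = weight n m (name (n + m) x)"
          using elim by (intro weight_name[symmetric]) auto
        finally show False using notin by (simp add: W_def)
      qed
    qed
    moreover have "{x. \<exists>m. birkhoff_sum \<phi> m x > real k} \<in> events"
    proof -
      have "{x \<in> space M. \<exists>m. birkhoff_sum \<phi> m x > real k} \<in> events" by measurable
      then show ?thesis by (simp add: space_UNIV)
    qed
    ultimately have "prob {x. name (n + m) x \<notin> W m} \<le> prob {x. \<exists>m. birkhoff_sum \<phi> m x > real k}"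
      by (intro finite_measure_mono_AE)
    with k show ?thesis by simp
  qed
  moreover have "\<exists>m>0. card (W m) \<le> K ^ (n + m)"
  proof -
    define s where "s = log 2 (real K) - c"
    have "s > 0" using c by (simp add: s_def)
    \<comment> \<open>The gain \<open>m * s\<close> has to absorb the constant
      \<open>k - log 2 \<delta>\<close>, which is independent of \<open>m\<close>; the 1 makes
      \<open>m\<close> positive.\<close>
    obtain m where m: "real m > max 1 ((real k - log 2 \<delta>) / s)" using reals_Archimedean2 by blast
    have "real k - log 2 \<delta> \<le> real m * s"
      using m \<open>s > 0\<close> by (simp add: pos_divide_less_eq)
    then have "real m * c + real k - log 2 \<delta> \<le> real m * log 2 (real K)"
      by (simp add: s_def algebra_simps)
    then have "2 powr (real m * c + real k - log 2 \<delta>) \<le> 2 powr (real m * log 2 (real K))"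
      by simp
    also have "2 powr (real m * c + real k - log 2 \<delta>) = 2 powr (real m * c + real k) / \<delta>"
      using \<delta>(1) by (simp add: powr_diff)
    also have "2 powr (real m * log 2 (real K)) = real K ^ m"
      using K(2) by (simp add: mult.commute[of "real m"] powr_powr[symmetric] powr_realpow)
    finally have "real (card (W m)) \<le> real K ^ m"
      by (rule order_trans[OF card_W])
    then have "card (W m) \<le> K ^ m" by (simp only: of_nat_power[symmetric] of_nat_le_iff)
    also have "\<dots> \<le> K ^ (n + m)" using K(2) by (intro power_increasing) auto
    finally show ?thesis using m by (intro exI[of _ m]) auto
  qed
  then obtain m where "m > 0" "card (W m) \<le> K ^ (n + m)" by blast
  moreover have "W m \<subseteq> words (n + m)" by (auto simp: W_def)
  ultimately show ?thesis by (intro exI[of _ "n + m"] exI[of _ "W m"]) auto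
qed


section \<open>Comparison with the entropy of partitions\<close>

text \<open>The members of the join correspond bijectively to the names that occur. All other words
  have empty cylinders and contribute zero.\<close>

lemma partition_entropy_iterated_join:
  "partition_entropy M (iterated_join f (range (\<lambda>x. a -` {a x})) n) = block_entropy n"
proof -
  let ?P = "range (\<lambda>x. a -` {a x})"
  have name_eq_iff: "name n y = name n x \<longleftrightarrow> (\<forall>i<n. a ((f ^^ i) y) = a ((f ^^ i) x))" for x y
    by (metis length_name nth_equalityI nth_name)
  have "iterated_join f ?P n = cylinder ` range (name n)"
  proof (intro set_eqI iffI)
    fix C assume "C \<in> iterated_join f ?P n"
    then obtain A where A: "A \<in> {..<n} \<rightarrow>\<^sub>E ?P" "C = (\<Inter>i<n. (f ^^ i) -` A i)" "C \<noteq> {}"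
      by (auto simp: iterated_join_def)
    then obtain x where x: "x \<in> C" by blast
    have "A i = a -` {a ((f ^^ i) x)}" if "i < n" for i
    proof -
      from A(1) that obtain z where "A i = a -` {a z}" by blast
      moreover from x A(2) that have "(f ^^ i) x \<in> A i" by blast
      ultimately show ?thesis by auto
    qed
    then have "C = cylinder (name n x)"
      unfolding A(2) cylinder_def by (auto simp: name_eq_iff)
    then show "C \<in> cylinder ` range (name n)" by blast
  next
    fix C assume "C \<in> cylinder ` range (name n)"
    then obtain x where C: "C = cylinder (name n x)" by blast
    define A where "A = (\<lambda>i\<in>{..<n}. a -` {a ((f ^^ i) x)})"
    have "A \<in> {..<n} \<rightarrow>\<^sub>E ?P" by (auto simp: A_def)
    moreover have "C = (\<Inter>i<n. (f ^^ i) -` A i)"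
      unfolding C cylinder_def A_def by (auto simp: name_eq_iff)
    moreover have "x \<in> C" by (simp add: C cylinder_def)
    ultimately show "C \<in> iterated_join f ?P n" unfolding iterated_join_def by blast
  qed
  moreover have "inj_on cylinder (range (name n))"
  proof (rule inj_onI)
    fix u v assume uv: "u \<in> range (name n)" "v \<in> range (name n)" "cylinder u = cylinder v"
    then obtain x where x: "u = name n x" by blast
    then have "x \<in> cylinder v" using uv(3) by (auto simp: cylinder_def)
    then show "u = v" using uv(2) x by (auto simp: cylinder_def)
  qed
  ultimately have "partition_entropy M (iterated_join f ?P n)
      = (\<Sum>w\<in>range (name n). cyl_prob w * - log 2 (cyl_prob w))"
    by (simp add: partition_entropy_def sum.reindex cyl_prob_def sum_negf)
  also have "\<dots> = block_entropy n"
    unfolding block_entropy_def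
  proof (rule sum.mono_neutral_left)
    show "\<forall>w\<in>words n - range (name n). cyl_prob w * - log 2 (cyl_prob w) = 0"
    proof
      fix w assume "w \<in> words n - range (name n)"
      then have "cylinder w = {}" by (auto simp: cylinder_def length_words)
      then show "cyl_prob w * - log 2 (cyl_prob w) = 0" by (simp add: cyl_prob_def)
    qed
  qed auto
  finally show ?thesis .
qed

text \<open>Fekete's lemma shows that the \<open>lim\<close> defining the entropy is a true limit
  and not an arbitrary value.\<close>

lemma tendsto_block_entropy:
  "(\<lambda>n. block_entropy n / real n) \<longlonglongrightarrow> entropy_wrt_partition M f (range (\<lambda>x. a -` {a x}))"
  using fekete_nonneg[OF block_entropy_subadditive block_entropy_nonneg]
  by (simp add: entropy_wrt_partition_def partition_entropy_iterated_join convergent_LIMSEQ_iff)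

lemma label_partition:
  shows "finite (range (\<lambda>x. a -` {a x}))" "range (\<lambda>x. a -` {a x}) \<subseteq> events"
    "partition_on UNIV (range (\<lambda>x. a -` {a x}))"
proof -
  have "range (\<lambda>x. a -` {a x}) \<subseteq> (\<lambda>i. a -` {i}) ` {..<r}" using label_less by auto
  then show "finite (range (\<lambda>x. a -` {a x}))" by (rule finite_subset) simp
  have "a -` {i} \<in> events" for i
    using measurable_sets[OF measurable_label, of "{i}"] by (simp add: space_UNIV)
  then show "range (\<lambda>x. a -` {a x}) \<subseteq> events" by auto
  show "partition_on UNIV (range (\<lambda>x. a -` {a x}))"
    by (rule partition_onI) (auto simp: disjnt_def)
qed

end

section \<open>Block coding and the estimation error\<close>

text \<open>While the block of states with indices \<open>k * L, \<dots>, k * L + L - 1\<close> unfolds, the coder sends the name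
  of the following block, which the dynamics determines from the initial state.\<close>

lemma block_coding:
  fixes \<mu> :: "'a::metric_space measure"
  assumes "labelled_map \<mu> f a r" and sets_\<mu>: "sets \<mu> = sets borel"
    and "L > 0" and "K > 0"
    and W: "W \<subseteq> labelled_map.words r L" "card W \<le> K ^ L"
  shows "\<exists>\<delta> \<gamma>. coding_policy {..<K} \<delta> \<and>
    (\<forall>t\<ge>L. \<forall>x. labelled_map.name f a L ((f ^^ (t div L * L)) x) \<in> W
      \<longrightarrow> a (estimate f \<delta> \<gamma> x t) = a ((f ^^ t) x))"
proof -
  interpret labelled_map \<mu> f a r by fact
  have "finite W" using W(1) finite_words by (rule finite_subset)
  \<comment> \<open>There are \<open>K ^ L\<close> strings of \<open>L\<close> channel symbols,
    enough to give each word of \<open>W\<close> its own.\<close>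
  then have "\<exists>enc. inj_on enc W \<and> enc ` W \<subseteq> ({..<L} \<rightarrow>\<^sub>E {..<K})"
    using W(2) by (subst inj_on_iff_card_le) (auto simp: card_PiE intro: finite_PiE)
  then obtain enc where enc: "inj_on enc W" "\<And>w. w \<in> W \<Longrightarrow> enc w \<in> {..<L} \<rightarrow>\<^sub>E {..<K}" by blast
  \<comment> \<open>Words outside \<open>W\<close> are sent as 0, a legal symbol since
    \<open>K > 0\<close>.\<close>
  define symbol where "symbol i w = (if w \<in> W then enc w i else 0)" for i w
  define \<delta> where "\<delta> t \<omega> = symbol (t mod L) (name L ((f ^^ (Suc (t div L) * L)) (\<omega> 0)))"
    for t and \<omega> :: "nat \<Rightarrow> 'a"
  define decode where "decode v = (SOME w. w \<in> W \<and> (\<forall>i<L. enc w i = v i))" for v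
  \<comment> \<open>The symbols of the preceding block are decoded, and \<open>inv a\<close> picks
    some point with the decoded label. For \<open>t < L\<close> the subtraction truncates to 0 and
    the estimate means nothing, hence the restriction to \<open>t \<ge> L\<close>.\<close>
  define \<gamma> where "\<gamma> t q = inv a (decode (\<lambda>i. q ((t div L - 1) * L + i)) ! (t mod L))"
    for t and q :: "nat \<Rightarrow> nat"
  have "coding_policy {..<K} \<delta>"
    unfolding coding_policy_def
  proof
    fix t
    have "symbol (t mod L) w < K" for w
    proof (cases "w \<in> W")
      case True
      then have "enc w (t mod L) \<in> {..<K}"
        using \<open>L > 0\<close> by (intro PiE_mem[OF enc(2)]) auto
      with True show ?thesis by (simp add: symbol_def)
    next
      case False
      with \<open>K > 0\<close> show ?thesis by (simp add: symbol_def)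
    qed
    then have symbol: "symbol (t mod L) \<in> count_space UNIV \<rightarrow>\<^sub>M count_space {..<K}"
      by simp
    have "(\<lambda>\<omega>. \<omega> 0) \<in> Pi\<^sub>M {..t} (\<lambda>_. borel) \<rightarrow>\<^sub>M (borel :: 'a measure)"
      by (rule measurable_component_singleton) simp
    then have initial: "(\<lambda>\<omega>. \<omega> 0) \<in> Pi\<^sub>M {..t} (\<lambda>_. borel) \<rightarrow>\<^sub>M \<mu>"
      by (simp only: measurable_cong_sets[OF refl sets_\<mu>])
    show "\<delta> t \<in> Pi\<^sub>M {..t} (\<lambda>_. borel) \<rightarrow>\<^sub>M count_space {..<K}"
      unfolding \<delta>_def[abs_def]
      by (rule measurable_compose[OF _ symbol], rule measurable_compose[OF _ measurable_name],
          rule measurable_compose[OF initial measurable_funpow])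
  qed
  moreover have "a (estimate f \<delta> \<gamma> x t) = a ((f ^^ t) x)"
    if "t \<ge> L" and w0: "name L ((f ^^ (t div L * L)) x) \<in> W" for t x
  proof -
    let ?w = "name L ((f ^^ (t div L * L)) x)"
    have "t div L \<noteq> 0" using that(1) \<open>L > 0\<close> by (simp add: div_eq_0_iff)
    then obtain k where k: "t div L = Suc k" by (cases "t div L") auto
    have le: "k * L + i \<le> t" if "i < L" for i
    proof -
      have "k * L + i \<le> (t div L) * L" using that k by simp
      also have "\<dots> \<le> t" by simp
      finally show ?thesis .
    qed
    have sym: "channel_symbol f \<delta> x (k * L + i) = enc ?w i" if "i < L" for i
    proof -
      have "Suc ((k * L + i) div L) = t div L" "(k * L + i) mod L = i" using that k by simp_all
      with w0 show ?thesis
        by (simp only: channel_symbol_def \<delta>_def symbol_def restrict_apply atMost_iff le0 if_True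
            funpow_0 if_P)
    qed
    have "decode (\<lambda>i. (\<lambda>s\<in>{..t}. channel_symbol f \<delta> x s) ((t div L - 1) * L + i)) = ?w"
      unfolding decode_def
    proof (rule some_equality)
      show "?w \<in> W \<and> (\<forall>i<L. enc ?w i = (\<lambda>s\<in>{..t}. channel_symbol f \<delta> x s) ((t div L - 1) * L + i))"
        using w0 sym le k by simp
    next
      fix w assume w: "w \<in> W \<and> (\<forall>i<L. enc w i = (\<lambda>s\<in>{..t}. channel_symbol f \<delta> x s) ((t div L - 1) * L + i))"
      then have "enc w i = enc ?w i" if "i < L" for i
        using that sym[OF that] le[OF that] k by simp
      then have "enc w = enc ?w"
        using enc(2) w w0 by (intro PiE_ext[of _ "{..<L}" "\<lambda>_. {..<K}"]) auto
      then show "w = ?w" using enc(1) w w0 by (auto dest: inj_onD)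
    qed
    then have "estimate f \<delta> \<gamma> x t = inv a (?w ! (t mod L))"
      by (simp add: estimate_def \<gamma>_def)
    also have "?w ! (t mod L) = a ((f ^^ (t mod L)) ((f ^^ (t div L * L)) x))"
      using \<open>L > 0\<close> by (intro nth_name) simp
    also have "(f ^^ (t mod L)) ((f ^^ (t div L * L)) x) = (f ^^ t) x"
      by (metis comp_apply funpow_add mod_div_mult_eq)
    finally show ?thesis by (simp add: f_inv_into_f)
  qed
  ultimately show ?thesis by blast
qed

text \<open>Total boundedness gives finitely many balls of radius \<open>e / 2\<close>. A point is
  labelled by the first ball containing it, which makes the fibres disjoint and measurable.\<close>

lemma small_labelling:
  assumes "compact (UNIV :: 'a::metric_space set)" and "e > 0"
  obtains a :: "'a::metric_space \<Rightarrow> nat" and r where "a \<in> borel \<rightarrow>\<^sub>M count_space UNIV"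
    and "\<And>x. a x < r" and "\<And>x y. a x = a y \<Longrightarrow> dist x y \<le> e"
proof -
  obtain C where "finite C" and C: "UNIV \<subseteq> (\<Union>x\<in>C. ball (x :: 'a) (e / 2))"
    using assms(1)[unfolded compact_eq_totally_bounded, THEN conjunct2, rule_format, of "e / 2"]
      \<open>e > 0\<close> by auto
  then obtain cs where cs: "set cs = C" using finite_list by blast
  define a where "a x = (LEAST i. i < length cs \<and> x \<in> ball (cs ! i) (e / 2))" for x
  have a: "a x < length cs \<and> x \<in> ball (cs ! a x) (e / 2)" for x
  proof -
    obtain c where "c \<in> set cs" "x \<in> ball c (e / 2)" using C cs by blast
    then have "\<exists>i. i < length cs \<and> x \<in> ball (cs ! i) (e / 2)" by (auto simp: in_set_conv_nth)
    then show ?thesis unfolding a_def by (rule LeastI_ex)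
  qed
  show thesis
  proof
    show "a \<in> borel \<rightarrow>\<^sub>M count_space UNIV"
      unfolding a_def[abs_def]
    proof (rule measurable_Least)
      fix i
      have "{x \<in> space borel. i < length cs \<and> x \<in> ball (cs ! i) (e / 2)} \<in> sets borel"
        by (cases "i < length cs") (simp_all del: mem_ball)
      then show "Measurable.pred borel (\<lambda>x. i < length cs \<and> x \<in> ball (cs ! i) (e / 2))"
        by (simp only: pred_def)
    qed
    show "a x < length cs" for x using a by blast
    show "dist x y \<le> e" if "a x = a y" for x y
    proof -
      have "dist (cs ! a x) x < e / 2" "dist (cs ! a x) y < e / 2" using a[of x] a[of y] that by auto
      then show ?thesis using dist_triangle_half_r less_imp_le by blast
    qed
  qed
qed

text \<open>From time \<open>L\<close> on, the error is at most \<open>e\<close> when the current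
  block has its name in \<open>W\<close>, and at most the diameter bound \<open>D\<close> otherwise;
  each case contributes at most \<open>\<epsilon> / 2\<close> to the mean.\<close>

lemma policy_above_entropy:
  fixes f :: "'a::metric_space \<Rightarrow> 'a"
  assumes compact: "compact (UNIV :: 'a set)" and cont: "continuous_on UNIV f"
    and "p > 0" and ergodic: "ergodic_measure \<mu> f"
    and K: "metric_entropy \<mu> f < ereal (log 2 (real K))" "K > 0" and "\<epsilon> > 0"
  shows "\<exists>\<delta> \<gamma>. coding_policy {..<K} \<delta> \<and> achieves_E3 f \<mu> p \<epsilon> \<delta> \<gamma>"
proof -
  have inv: "prob_space \<mu>" and sets_\<mu>: "sets \<mu> = sets borel"
    and pres: "\<And>A. A \<in> sets borel \<Longrightarrow> measure \<mu> (f -` A) = measure \<mu> A"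
    using ergodic by (auto simp: ergodic_measure_def invariant_borel_prob_def)
  interpret prob_space \<mu> by (rule inv)
  have space_\<mu>: "space \<mu> = UNIV" using sets_eq_imp_space_eq[OF sets_\<mu>] by simp
  have f_meas: "f \<in> \<mu> \<rightarrow>\<^sub>M \<mu>"
    using borel_measurable_continuous_onI[OF cont] by (simp add: measurable_cong_sets[OF sets_\<mu> sets_\<mu>])
  have "distr \<mu> \<mu> f = \<mu>"
    by (rule measure_eqI)
      (simp_all add: emeasure_distr f_meas space_\<mu> emeasure_eq_measure pres sets_\<mu>)
  then have map: "measure_preserving_map \<mu> f"
    by unfold_locales (auto simp: space_\<mu> f_meas)
  define e where "e = (\<epsilon> / 2) powr (1 / p)"
  have e: "e > 0" "e powr p = \<epsilon> / 2"
    using \<open>\<epsilon> > 0\<close> \<open>p > 0\<close> by (auto simp: e_def powr_powr)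
  obtain D where D: "\<And>x y :: 'a. dist x y \<le> D"
    using compact_imp_bounded[OF compact] unfolding bounded_two_points by auto
  have "D \<ge> 0" using D[of undefined undefined] by simp
  \<comment> \<open>The added 1 keeps the denominator positive when \<open>D = 0\<close>.\<close>
  define \<eta> where "\<eta> = \<epsilon> / 2 / (D powr p + 1)"
  have "D powr p + 1 > 0" by (simp add: add_nonneg_pos)
  then have "\<eta> > 0" using \<open>\<epsilon> > 0\<close> by (simp add: \<eta>_def)
  have \<eta>: "D powr p * \<eta> \<le> \<epsilon> / 2"
    using \<open>\<epsilon> > 0\<close> \<open>D powr p + 1 > 0\<close> by (simp add: \<eta>_def field_simps)
  obtain a :: "'a \<Rightarrow> nat" and r where a: "a \<in> borel \<rightarrow>\<^sub>M count_space UNIV"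
    "\<And>x. a x < r" "\<And>x y. a x = a y \<Longrightarrow> dist x y \<le> e"
    using small_labelling[OF compact e(1)] by metis
  have lab: "labelled_map \<mu> f a r"
    using map a(1,2) by (intro labelled_map.intro labelled_map_axioms.intro)
      (simp_all add: measurable_cong_sets[OF sets_\<mu> refl])
  interpret labelled_map \<mu> f a r by (rule lab)
  have "ereal (entropy_wrt_partition \<mu> f (range (\<lambda>x. a -` {a x}))) \<le> metric_entropy \<mu> f"
    unfolding metric_entropy_def using label_partition sets_\<mu>
    by (intro SUP_upper) (simp add: finite_borel_partition_def)
  with K(1) have "entropy_wrt_partition \<mu> f (range (\<lambda>x. a -` {a x})) < log 2 (real K)"
    using order_le_less_trans by fastforce
  then obtain L W where LW: "L > 0" "W \<subseteq> words L" "card W \<le> K ^ L" "prob {x. name L x \<notin> W} < \<eta>"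
    using few_words_carry_most_mass[OF _ tendsto_block_entropy _ K(2) \<open>\<eta> > 0\<close>] ergodic sets_\<mu>
    by (auto simp: ergodic_measure_def)
  obtain \<delta> \<gamma> where policy: "coding_policy {..<K} \<delta>"
    and correct: "\<And>t x. t \<ge> L \<Longrightarrow> name L ((f ^^ (t div L * L)) x) \<in> W \<Longrightarrow>
      a (estimate f \<delta> \<gamma> x t) = a ((f ^^ t) x)"
    using block_coding[OF lab sets_\<mu> LW(1) K(2) LW(2,3)] by blast
  have "(\<integral>\<^sup>+ x. ennreal (dist ((f ^^ t) x) (estimate f \<delta> \<gamma> x t) powr p) \<partial>\<mu>) \<le> ennreal \<epsilon>"
    if "t \<ge> L" for t
  proof -
    \<comment> \<open>The initial states whose current block is not decodable. By invariance the
      probability of this set does not depend on \<open>t\<close>, so the error bound is uniform in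
      time.\<close>
    let ?B = "(f ^^ (t div L * L)) -` {x. name L x \<notin> W}"
    have B: "?B \<in> sets \<mu>"
      using measurable_sets[OF measurable_funpow Collect_name_events[of "\<lambda>w. w \<notin> W" L]]
      by (simp add: space_UNIV)
    have prob_B: "prob ?B < \<eta>"
      using LW(4) prob_vimage_funpow[OF Collect_name_events[of "\<lambda>w. w \<notin> W" L]] by (simp only:)
    have "ennreal (dist ((f ^^ t) x) (estimate f \<delta> \<gamma> x t) powr p)
        \<le> ennreal (e powr p) + ennreal (D powr p) * indicator ?B x" for x
    proof (cases "x \<in> ?B")
      case True
      have "dist ((f ^^ t) x) (estimate f \<delta> \<gamma> x t) powr p \<le> D powr p"
        using D \<open>p > 0\<close> by (intro powr_mono2) auto
      with True show ?thesis by (auto simp: ennreal_leI intro: add_increasing)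
    next
      case False
      then have "dist ((f ^^ t) x) (estimate f \<delta> \<gamma> x t) \<le> e"
        using correct[OF that] by (intro a(3)) auto
      then have "dist ((f ^^ t) x) (estimate f \<delta> \<gamma> x t) powr p \<le> e powr p"
        using \<open>p > 0\<close> by (intro powr_mono2) auto
      with False show ?thesis by (simp add: ennreal_leI)
    qed
    then have "(\<integral>\<^sup>+ x. ennreal (dist ((f ^^ t) x) (estimate f \<delta> \<gamma> x t) powr p) \<partial>\<mu>)
        \<le> (\<integral>\<^sup>+ x. ennreal (e powr p) + ennreal (D powr p) * indicator ?B x \<partial>\<mu>)"
      by (intro nn_integral_mono)
    also have "\<dots> = ennreal (e powr p) + ennreal (D powr p) * emeasure \<mu> ?B"
      using B by (simp add: nn_integral_add nn_integral_cmult emeasure_space_1)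
    also have "\<dots> = ennreal (e powr p + D powr p * prob ?B)"
      by (simp add: emeasure_eq_measure ennreal_plus ennreal_mult)
    also have "\<dots> \<le> ennreal \<epsilon>"
    proof (rule ennreal_leI)
      have "D powr p * prob ?B \<le> D powr p * \<eta>" using prob_B by (intro mult_left_mono) auto
      with e(2) \<eta> show "e powr p + D powr p * prob ?B \<le> \<epsilon>" by linarith
    qed
    finally show ?thesis .
  qed
  then have "achieves_E3 f \<mu> p \<epsilon> \<delta> \<gamma>"
    unfolding achieves_E3_def by (intro Limsup_bounded eventually_sequentiallyI[of L])
  with policy show ?thesis by blast
qed

theorem theoremV1:
  fixes f g :: "'a::metric_space \<Rightarrow> 'a" and \<pi>0 :: "'a measure" and p :: real
  assumes "compact (UNIV :: 'a set)"
    and "homeomorphism UNIV UNIV f g"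
    and "p > 0"
    and "ergodic_measure \<pi>0 f"
  shows "smallest_capacity f \<pi>0 p \<le>
    (if metric_entropy \<pi>0 f = \<infinity> then \<infinity>
     else ereal (log 2 (1 + real_of_int \<lfloor>2 powr real_of_ereal (metric_entropy \<pi>0 f)\<rfloor>)))"
proof (cases "metric_entropy \<pi>0 f = \<infinity>")
  case False
  define h where "h = real_of_ereal (metric_entropy \<pi>0 f)"
  have "metric_entropy \<pi>0 f \<le> ereal h"
    using False unfolding h_def by (cases "metric_entropy \<pi>0 f") auto
  \<comment> \<open>The least integer strictly above \<open>2 powr h\<close>; its logarithm
    therefore exceeds the entropy strictly.\<close>
  define K where "K = nat (1 + \<lfloor>2 powr h\<rfloor>)"
  have floor_nonneg: "0 \<le> \<lfloor>2 powr h\<rfloor>" by simp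
  have real_K: "real K = 1 + real_of_int \<lfloor>2 powr h\<rfloor>"
    using floor_nonneg by (simp add: K_def)
  have "2 powr h < real K" unfolding real_K by linarith
  then have "0 < real K" by (rule le_less_trans[OF powr_ge_zero])
  then have "K > 0" by simp
  have "h < log 2 (real K)" using \<open>2 powr h < real K\<close> \<open>K > 0\<close> by (simp add: less_log_iff)
  with \<open>metric_entropy \<pi>0 f \<le> ereal h\<close> have less: "metric_entropy \<pi>0 f < ereal (log 2 (real K))"
    by (meson ereal_less(2) le_less_trans less_ereal.simps(1))
  have cont: "continuous_on UNIV f" using assms(2) by (simp add: homeomorphism_def)
  \<comment> \<open>The same alphabet serves every \<open>\<epsilon>\<close>, so the bound survives
    the supremum.\<close>
  have "capacity_eps f \<pi>0 p \<epsilon> \<le> ereal (log 2 (real K))" if "\<epsilon> > 0" for \<epsilon>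
    unfolding capacity_eps_def
  proof (rule Inf_lower, rule CollectI, rule exI[of _ "{..<K}"], intro conjI)
    show "ereal (log 2 (real K)) = ereal (log 2 (real (card {..<K})))" by simp
    show "{..<K} \<noteq> {}" using \<open>K > 0\<close> by auto
    show "\<exists>\<delta> \<gamma>. coding_policy {..<K} \<delta> \<and> achieves_E3 f \<pi>0 p \<epsilon> \<delta> \<gamma>"
      by (rule policy_above_entropy[OF assms(1) cont assms(3,4) less \<open>K > 0\<close> that])
  qed simp
  then show ?thesis
    using False unfolding smallest_capacity_eq_SUP by (auto simp: real_K h_def intro!: SUP_least)
qed simp

end
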